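(* Let $\alpha,\beta,\gamma\in\mathcal{L}$ be Lipschitz integers such that $\beta\perp\alpha$ and $\gamma\perp\alpha$. Then $$\alpha\times\beta\times\gamma\in\alpha\mathcal{L}\cap\mathcal{L}\alpha .$$
   Context: $\mathbb{H}$ is the real quaternion algebra with basis $1,i,j,k$ ($i^2=j^2=k^2=ijk=-1$), identified with $\mathbb{R}^4$ via $(1,i,j,k)=(\mathbf{e}_1,\mathbf{e}_2,\mathbf{e}_3,\mathbf{e}_4)$. $\mathcal{L}=\mathbb{Z}+\mathbb{Z}i+\mathbb{Z}j+\mathbb{Z}k$ is the ring of Lipschitz integers; $\alpha\mathcal{L}=\{\alpha x: x\in\mathcal{L}\}$ and $\mathcal{L}\alpha=\{x\alpha: x\in\mathcal{L}\}$. $u\perp v$ means $u\cdot v=0$ for the standard inner product of $\mathbb{R}^4$. The ternary vector product of $u,v,w\in\mathbb{H}$, with $u=u_0+u_1i+u_2j+u_3k$ and similarly for $v,w$, is $$u\times v\times w=\begin{vmatrix}u_0&u_1&u_2&u_3\\ v_0&v_1&v_2&v_3\\ w_0&w_1&w_2&w_3\\ 1&i&j&k\end{vmatrix},$$ the formal determinant being computed by Laplace expansion along the last row. *)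

theory Defs
  imports "HOL-Analysis.Analysis"
begin

section \<open>The real quaternion algebra\<close>

text \<open>
  \<^term>\<open>Quat a b c d\<close> stands for $a + bi + cj + dk$, that is, for the vector
  $(a,b,c,d)$ of $\mathbb{R}^4$.
\<close>

codatatype quat = Quat (q0: real) (q1: real) (q2: real) (q3: real)

lemma quat_eq_iff: "x = y \<longleftrightarrow> q0 x = q0 y \<and> q1 x = q1 y \<and> q2 x = q2 y \<and> q3 x = q3 y"
  by (auto intro: quat.expand)

instantiation quat :: ring_1
begin

primcorec zero_quat where
  "q0 0 = 0" | "q1 0 = 0" | "q2 0 = 0" | "q3 0 = 0"

primcorec one_quat where
  "q0 1 = 1" | "q1 1 = 0" | "q2 1 = 0" | "q3 1 = 0"

primcorec plus_quat where
  "q0 (x + y) = q0 x + q0 y"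
| "q1 (x + y) = q1 x + q1 y"
| "q2 (x + y) = q2 x + q2 y"
| "q3 (x + y) = q3 x + q3 y"

primcorec uminus_quat where
  "q0 (- x) = - q0 x"
| "q1 (- x) = - q1 x"
| "q2 (- x) = - q2 x"
| "q3 (- x) = - q3 x"

primcorec minus_quat where
  "q0 (x - y) = q0 x - q0 y"
| "q1 (x - y) = q1 x - q1 y"
| "q2 (x - y) = q2 x - q2 y"
| "q3 (x - y) = q3 x - q3 y"

primcorec times_quat where
  "q0 (x * y) = q0 x * q0 y - q1 x * q1 y - q2 x * q2 y - q3 x * q3 y"
| "q1 (x * y) = q0 x * q1 y + q1 x * q0 y + q2 x * q3 y - q3 x * q2 y"
| "q2 (x * y) = q0 x * q2 y - q1 x * q3 y + q2 x * q0 y + q3 x * q1 y"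
| "q3 (x * y) = q0 x * q3 y + q1 x * q2 y - q2 x * q1 y + q3 x * q0 y"

instance
  by standard (simp_all add: quat_eq_iff algebra_simps)

end

instantiation quat :: real_algebra_1
begin

primcorec scaleR_quat where
  "q0 (r *\<^sub>R x) = r * q0 x"
| "q1 (r *\<^sub>R x) = r * q1 x"
| "q2 (r *\<^sub>R x) = r * q2 x"
| "q3 (r *\<^sub>R x) = r * q3 x"

instance
  by standard (simp_all add: quat_eq_iff algebra_simps)

end

instantiation quat :: real_inner
begin

definition inner_quat :: "quat \<Rightarrow> quat \<Rightarrow> real" where
  "inner_quat x y = q0 x * q0 y + q1 x * q1 y + q2 x * q2 y + q3 x * q3 y"

definition norm_quat :: "quat \<Rightarrow> real" where
  "norm_quat x = sqrt (inner x x)"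

definition sgn_quat :: "quat \<Rightarrow> quat" where
  "sgn_quat x = x /\<^sub>R norm x"

definition dist_quat :: "quat \<Rightarrow> quat \<Rightarrow> real" where
  "dist_quat x y = norm (x - y)"

definition uniformity_quat :: "(quat \<times> quat) filter" where
  "uniformity_quat = (INF e\<in>{0 <..}. principal {(x, y). dist x y < e})"

definition open_quat :: "quat set \<Rightarrow> bool" where
  "open_quat U \<longleftrightarrow> (\<forall>x\<in>U. eventually (\<lambda>(x', y). x' = x \<longrightarrow> y \<in> U) uniformity)"

instance
proof
  fix x y z :: quat and r :: real and U :: "quat set"
  show "dist x y = norm (x - y)" by (rule dist_quat_def)
  show "sgn x = x /\<^sub>R norm x" by (rule sgn_quat_def)
  show "(uniformity :: (quat \<times> quat) filter) = (INF e\<in>{0 <..}. principal {(x, y). dist x y < e})"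
    by (rule uniformity_quat_def)
  show "open U \<longleftrightarrow> (\<forall>x\<in>U. eventually (\<lambda>(x', y). x' = x \<longrightarrow> y \<in> U) uniformity)"
    by (rule open_quat_def)
  show "norm x = sqrt (inner x x)" by (rule norm_quat_def)
  show "inner x y = inner y x" "inner (x + y) z = inner x z + inner y z"
    "inner (r *\<^sub>R x) y = r * inner x y" "0 \<le> inner x x"
    by (simp_all add: inner_quat_def algebra_simps)
  show "inner x x = 0 \<longleftrightarrow> x = 0"
    by (auto simp: inner_quat_def quat_eq_iff add_nonneg_eq_0_iff)
qed

end

definition quat_i :: quat where "quat_i = Quat 0 1 0 0"
definition quat_j :: quat where "quat_j = Quat 0 0 1 0"
definition quat_k :: quat where "quat_k = Quat 0 0 0 1"

lemma quat_relations:
  "quat_i ^ 2 = -1" "quat_j ^ 2 = -1" "quat_k ^ 2 = -1" "quat_i * quat_j * quat_k = -1"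
  by (simp_all add: quat_eq_iff quat_i_def quat_j_def quat_k_def power2_eq_square)

lemma quat_expansion:
  "Quat a b c d = of_real a + of_real b * quat_i + of_real c * quat_j + of_real d * quat_k"
  by (simp add: quat_eq_iff quat_i_def quat_j_def quat_k_def of_real_def)

section \<open>Lipschitz integers\<close>

definition Lipschitz_ints :: "quat set" where
  "Lipschitz_ints =
    {of_int a + of_int b * quat_i + of_int c * quat_j + of_int d * quat_k | a b c d. True}"

lemma Lipschitz_ints_iff:
  "x \<in> Lipschitz_ints \<longleftrightarrow> q0 x \<in> \<int> \<and> q1 x \<in> \<int> \<and> q2 x \<in> \<int> \<and> q3 x \<in> \<int>"
proof -
  have "of_int a + of_int b * quat_i + of_int c * quat_j + of_int d * quat_k =
      Quat (of_int a) (of_int b) (of_int c) (of_int d)" for a b c d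
    by (simp add: quat_expansion)
  then have "Lipschitz_ints = {Quat (of_int a) (of_int b) (of_int c) (of_int d) | a b c d. True}"
    by (simp add: Lipschitz_ints_def)
  then show ?thesis
    by (auto simp: Ints_def quat_eq_iff)
qed

section \<open>The ternary vector product\<close>

text \<open>
  \<open>minor3 u v w c c' c''\<close> is the $3 \times 3$ minor of the matrix with rows $u, v, w$
  formed by the columns that the coordinate functions $c, c', c''$ select.
\<close>

definition minor3 ::
  "quat \<Rightarrow> quat \<Rightarrow> quat \<Rightarrow> (quat \<Rightarrow> real) \<Rightarrow> (quat \<Rightarrow> real) \<Rightarrow> (quat \<Rightarrow> real) \<Rightarrow> real" where
  "minor3 u v w c c' c'' =
    det (vector [vector [c u, c' u, c'' u],
                 vector [c v, c' v, c'' v],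
                 vector [c w, c' w, c'' w]] :: real^3^3)"

text \<open>
  Laplace expansion, along the last row, of the formal determinant with rows
  $u$, $v$, $w$ and $(1, i, j, k)$; the sign at column $n$ is $(-1)^{4+n}$.
\<close>

definition ternary_prod :: "quat \<Rightarrow> quat \<Rightarrow> quat \<Rightarrow> quat" where
  "ternary_prod u v w =
    - (minor3 u v w q1 q2 q3 *\<^sub>R 1)
    + minor3 u v w q0 q2 q3 *\<^sub>R quat_i
    - minor3 u v w q0 q1 q3 *\<^sub>R quat_j
    + minor3 u v w q0 q1 q2 *\<^sub>R quat_k"

end

theory Submission
  imports Defs
begin

text \<open>
  The ternary product is the alternating part of a product of three quaternions:
  $2(u \times v \times w) = w \bar v u - u \bar v w$. Since
  $x \bar y = 2 (x \cdot y) - y \bar x$, the factor $u$ can be moved to the left in the first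
  term or to the right in the second one, at the price of multiples of $u \cdot v$ and
  $u \cdot w$. When $u$ is orthogonal to $v$ and $w$ this leaves
  $u \, \mathrm{Im}(\bar w v) = \mathrm{Im}(w \bar v) \, u$, and the imaginary part of a
  Lipschitz integer is again one.
\<close>

definition quat_cnj :: "quat \<Rightarrow> quat" where
  "quat_cnj x = Quat (q0 x) (- q1 x) (- q2 x) (- q3 x)"

definition quat_Im :: "quat \<Rightarrow> quat" where
  "quat_Im x = Quat 0 (q1 x) (q2 x) (q3 x)"

text \<open>In \<open>w * cnj v * u\<close>, rewrite \<open>cnj v * u\<close> as
  \<open>2(u.v) - cnj u * v\<close>, then \<open>w * cnj u\<close> as
  \<open>2(u.w) - u * cnj w\<close>. As \<open>cnj v * w\<close> is conjugate to
  \<open>cnj w * v\<close>, their difference is twice an imaginary part.\<close>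

lemma ternary_prod_eq_left_multiple:
  "ternary_prod u v w = u * quat_Im (quat_cnj w * v) + inner u v *\<^sub>R w - inner u w *\<^sub>R v"
  by (simp add: quat_eq_iff ternary_prod_def minor3_def det_3 quat_cnj_def quat_Im_def
      inner_quat_def quat_i_def quat_j_def quat_k_def algebra_simps)

text \<open>Here \<open>u\<close> moves through the subtracted term \<open>u * cnj v * w\<close>,
  hence the opposite signs of the corrections.\<close>

lemma ternary_prod_eq_right_multiple:
  "ternary_prod u v w = quat_Im (w * quat_cnj v) * u - inner u v *\<^sub>R w + inner u w *\<^sub>R v"
  by (simp add: quat_eq_iff ternary_prod_def minor3_def det_3 quat_cnj_def quat_Im_def
      inner_quat_def quat_i_def quat_j_def quat_k_def algebra_simps)

lemma Lipschitz_ints_mult: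
  "x \<in> Lipschitz_ints \<Longrightarrow> y \<in> Lipschitz_ints \<Longrightarrow> x * y \<in> Lipschitz_ints"
  by (simp add: Lipschitz_ints_iff)

lemma Lipschitz_ints_cnj: "x \<in> Lipschitz_ints \<Longrightarrow> quat_cnj x \<in> Lipschitz_ints"
  by (simp add: Lipschitz_ints_iff quat_cnj_def)

text \<open>Although \<open>Im x = (x - cnj x)/2\<close>, no half-integers arise: only the real
  coordinate is dropped.\<close>

lemma Lipschitz_ints_Im: "x \<in> Lipschitz_ints \<Longrightarrow> quat_Im x \<in> Lipschitz_ints"
  by (simp add: Lipschitz_ints_iff quat_Im_def)

theorem theorem5p3:
  fixes \<alpha> \<beta> \<gamma> :: quat
  assumes "\<alpha> \<in> Lipschitz_ints" and "\<beta> \<in> Lipschitz_ints" and "\<gamma> \<in> Lipschitz_ints"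
    and "orthogonal \<beta> \<alpha>" and "orthogonal \<gamma> \<alpha>"
  shows "ternary_prod \<alpha> \<beta> \<gamma> \<in> {\<alpha> * x | x. x \<in> Lipschitz_ints} \<inter> {x * \<alpha> | x. x \<in> Lipschitz_ints}"
proof -
  have "inner \<alpha> \<beta> = 0" "inner \<alpha> \<gamma> = 0"
    using assms by (simp_all add: orthogonal_def inner_commute)
  then have "ternary_prod \<alpha> \<beta> \<gamma> = \<alpha> * quat_Im (quat_cnj \<gamma> * \<beta>)"
    and "ternary_prod \<alpha> \<beta> \<gamma> = quat_Im (\<gamma> * quat_cnj \<beta>) * \<alpha>"
    using ternary_prod_eq_left_multiple[of \<alpha> \<beta> \<gamma>]
      ternary_prod_eq_right_multiple[of \<alpha> \<beta> \<gamma>]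
    by simp_all
  moreover have "quat_Im (quat_cnj \<gamma> * \<beta>) \<in> Lipschitz_ints"
    and "quat_Im (\<gamma> * quat_cnj \<beta>) \<in> Lipschitz_ints"
    using assms by (simp_all add: Lipschitz_ints_mult Lipschitz_ints_cnj Lipschitz_ints_Im)
  ultimately show ?thesis
    by blast
qed

end
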